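(* If $G$ is a star forest with $m$ edges and $q$ components, where each component has at least three edges, then $$\tau(G)\leq\min\left\{-q(3+2\sqrt{2})+(1+\sqrt{2})\left(m+\tfrac{1}{2}\right),\ 2m+1\right\}.$$
   Context: Graphs are finite and simple, not necessarily connected. For a graph $G$ with $m$ edges and a bijection $f: E(G)\to\{1,2,\dots,m\}$, let $\phi_f(v)$ be the sum of $f(e)$ over all edges $e$ incident to the vertex $v$. The bijection $f$ is an antimagic labeling of $G$ if $\phi_f(u)\neq\phi_f(v)$ for all pairs of distinct vertices $u,v$; $G$ is antimagic if it admits an antimagic labeling. $P_j$ is the path on $j$ vertices. $G\cup H$ denotes disjoint union, and $tG$ the disjoint union of $t$ copies of $G$. An $n$-star $S_n$ is a tree with a center vertex $v$ and $n$ pendant edges incident to $v$. A star forest is a forest whose components are stars. If $G$ is antimagic, $\tau(G)$ is the maximum non-negative integer $t$ such that $G\cup t'P_3$ is antimagic for all integers $0\leq t'\leq t$; if $G$ is not antimagic, $\tau(G)=-\infty$. *)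

theory Defs
  imports Complex_Main "HOL-Library.Extended_Real"
begin

datatype 'a sgraph = SGraph (verts: "'a set") (edges: "'a set set")

definition simple_graph :: "'a sgraph \<Rightarrow> bool" where
  "simple_graph G \<longleftrightarrow> finite (verts G) \<and> (\<forall>e\<in>edges G. e \<subseteq> verts G \<and> card e = 2)"

definition vertex_sum :: "'a sgraph \<Rightarrow> ('a set \<Rightarrow> nat) \<Rightarrow> 'a \<Rightarrow> nat" where
  "vertex_sum G f v = (\<Sum>e | e \<in> edges G \<and> v \<in> e. f e)"

definition antimagic_labeling :: "'a sgraph \<Rightarrow> ('a set \<Rightarrow> nat) \<Rightarrow> bool" where
  "antimagic_labeling G f \<longleftrightarrow>
     bij_betw f (edges G) {1..card (edges G)} \<and>
     (\<forall>u\<in>verts G. \<forall>v\<in>verts G. u \<noteq> v \<longrightarrow> vertex_sum G f u \<noteq> vertex_sum G f v)"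

definition antimagic :: "'a sgraph \<Rightarrow> bool" where
  "antimagic G \<longleftrightarrow> (\<exists>f. antimagic_labeling G f)"

definition path_graph :: "nat \<Rightarrow> nat sgraph" where
  "path_graph j = SGraph {..<j} {{i, Suc i} | i. Suc i < j}"

definition disjoint_union :: "'a sgraph \<Rightarrow> 'b sgraph \<Rightarrow> ('a + 'b) sgraph" where
  "disjoint_union G H =
     SGraph (verts G <+> verts H) ((`) Inl ` edges G \<union> (`) Inr ` edges H)"

definition copies :: "nat \<Rightarrow> 'a sgraph \<Rightarrow> (nat \<times> 'a) sgraph" where
  "copies t G = SGraph ({..<t} \<times> verts G) {Pair i ` e | i e. i < t \<and> e \<in> edges G}"

definition adjacency :: "'a sgraph \<Rightarrow> ('a \<times> 'a) set" where
  "adjacency G = {(u, v). {u, v} \<in> edges G}"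

definition connectivity :: "'a sgraph \<Rightarrow> ('a \<times> 'a) set" where
  "connectivity G = {(u, v). u \<in> verts G \<and> v \<in> verts G \<and> (u, v) \<in> (adjacency G)\<^sup>*}"

definition induced_subgraph :: "'a sgraph \<Rightarrow> 'a set \<Rightarrow> 'a sgraph" where
  "induced_subgraph G W = SGraph W {e \<in> edges G. e \<subseteq> W}"

definition components :: "'a sgraph \<Rightarrow> 'a sgraph set" where
  "components G = induced_subgraph G ` (verts G // connectivity G)"

definition n_star :: "nat \<Rightarrow> 'a sgraph \<Rightarrow> bool" where
  "n_star n H \<longleftrightarrow>
     (\<exists>v L. v \<notin> L \<and> finite L \<and> card L = n \<and> H = SGraph (insert v L) ((\<lambda>x. {v, x}) ` L))"

definition star_forest :: "'a sgraph \<Rightarrow> bool" where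
  "star_forest G \<longleftrightarrow> simple_graph G \<and> (\<forall>C\<in>components G. \<exists>n. n_star n C)"

definition tau_admissible :: "'a sgraph \<Rightarrow> nat \<Rightarrow> bool" where
  "tau_admissible G t \<longleftrightarrow>
     (\<forall>t'\<le>t. antimagic (disjoint_union G (copies t' (path_graph 3))))"

text \<open>The maximum is taken as a supremum in the extended reals: it agrees with the maximum
  whenever that exists (lemma \<open>tau_eq_maximum\<close>), and is \<open>\<infinity>\<close> if every \<open>t\<close> is
  admissible, so an upper bound on \<open>tau G\<close> also asserts that the maximum exists.\<close>

definition tau :: "'a sgraph \<Rightarrow> ereal" where
  "tau G = (if antimagic G then (SUP t\<in>{t. tau_admissible G t}. ereal (real t)) else -\<infinity>)"

lemma tau_eq_maximum:
  assumes "antimagic G" "tau_admissible G t" "\<And>s. tau_admissible G s \<Longrightarrow> s \<le> t"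
  shows "tau G = ereal (real t)"
  unfolding tau_def using assms by (auto intro!: antisym SUP_least SUP_upper)

end

theory Submission
  imports Defs
begin

text \<open>
  In a star with at least two edges, every edge has exactly one leaf, and the sum at that leaf is
  the label of the edge. Hence in an antimagic labeling of a disjoint union of such stars with
  \<open>N\<close> edges the leaf sums already exhaust \<open>{1..N}\<close>, and the centers must have distinct sums that
  all exceed \<open>N\<close>. On the other hand the center sums are made of the labels, each used once, so
  they cannot be too large in total. The inequality \<open>antimagic_centers_inequality\<close> records this
  conflict for an arbitrary set \<open>Y\<close> of centers: the sums at \<open>Y\<close> total at least
  \<open>(N + 1) + \<dots> + (N + card Y)\<close>, while the \<open>r\<close> edges that avoid \<open>Y\<close> carry labels of total
  at least \<open>1 + \<dots> + r\<close>, which are missing from the sums at \<open>Y\<close>.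

  For \<open>G \<union> tP\<^sub>3\<close> we have \<open>N = m + 2t\<close>. Taking for \<open>Y\<close> the \<open>t\<close> centers of the copies of \<open>P\<^sub>3\<close>
  (so that \<open>r = m\<close>) gives \<open>t \<le> 2m + 1\<close>. Taking all \<open>q + t\<close> centers (so that \<open>r = 0\<close>) gives a
  quadratic inequality in \<open>t\<close>; with \<open>a = m + 1/2\<close> it reads
  \<open>(t - (a - 3q))\<^sup>2 \<le> 2(a - 2q)\<^sup>2 - 1/4\<close>. As every component has at least three edges,
  \<open>a \<ge> 2q\<close>, and taking square roots gives the other bound.
\<close>

section \<open>Systems of star centers\<close>

text \<open>
  This is all that the counting argument uses about a star forest without isolated vertices. Unlike
  a description by connected components, it passes directly to disjoint unions. In a component
  with a single edge either end may be taken as the center.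
\<close>

definition star_centers :: "'a sgraph \<Rightarrow> 'a set \<Rightarrow> bool" where
  "star_centers G Z \<longleftrightarrow> Z \<subseteq> verts G \<and> (\<forall>z\<in>Z. \<exists>e\<in>edges G. z \<in> e) \<and>
     (\<forall>e\<in>edges G. \<exists>z\<in>Z. \<exists>x\<in>verts G - Z. e = {z, x} \<and> (\<forall>e'\<in>edges G. x \<in> e' \<longrightarrow> e' = e))"

lemma star_centers_meet_edge:
  assumes "star_centers G Z" "e \<in> edges G" shows "e \<inter> Z \<noteq> {}"
proof -
  obtain z x where "z \<in> Z" "e = {z, x}" using assms unfolding star_centers_def by meson
  then show ?thesis by auto
qed

lemma simple_graph_finite_edges:
  assumes "simple_graph G" shows "finite (edges G)"
proof (rule finite_subset)
  show "edges G \<subseteq> Pow (verts G)" using assms unfolding simple_graph_def by blast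
  show "finite (Pow (verts G))" using assms unfolding simple_graph_def by simp
qed

lemma simple_graph_disjoint_union:
  assumes "simple_graph G" "simple_graph H"
  shows "simple_graph (disjoint_union G H)"
  unfolding simple_graph_def
proof (intro conjI ballI)
  show "finite (verts (disjoint_union G H))"
    using assms unfolding simple_graph_def disjoint_union_def by simp
next
  fix e assume "e \<in> edges (disjoint_union G H)"
  then consider d where "d \<in> edges G" "e = Inl ` d" | d where "d \<in> edges H" "e = Inr ` d"
    unfolding disjoint_union_def by auto
  then have "e \<subseteq> verts (disjoint_union G H) \<and> card e = 2"
  proof cases
    case 1
    then have "d \<subseteq> verts G" "card d = 2" using assms(1) unfolding simple_graph_def by auto
    then show ?thesis using 1 by (auto simp: disjoint_union_def card_image)
  next
    case 2
    then have "d \<subseteq> verts H" "card d = 2" using assms(2) unfolding simple_graph_def by auto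
    then show ?thesis using 2 by (auto simp: disjoint_union_def card_image)
  qed
  then show "e \<subseteq> verts (disjoint_union G H)" "card e = 2" by auto
qed

lemma simple_graph_copies:
  assumes "simple_graph G" shows "simple_graph (copies t G)"
  unfolding simple_graph_def
proof (intro conjI ballI)
  show "finite (verts (copies t G))"
    using assms unfolding simple_graph_def copies_def by simp
next
  fix e assume "e \<in> edges (copies t G)"
  then obtain i d where d: "i < t" "d \<in> edges G" "e = Pair i ` d"
    unfolding copies_def by auto
  then have "d \<subseteq> verts G" "card d = 2" using assms unfolding simple_graph_def by auto
  then show "e \<subseteq> verts (copies t G)" "card e = 2"
    using d by (auto simp: copies_def card_image inj_on_def)
qed

lemma card_edges_disjoint_union:
  fixes G :: "'a sgraph" and H :: "'b sgraph"
  assumes "simple_graph G" "simple_graph H"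
  shows "card (edges (disjoint_union G H)) = card (edges G) + card (edges H)"
proof -
  have "(`) Inl ` edges G \<inter> (`) Inr ` edges H = {}"
  proof -
    have "{} \<notin> edges G" using assms unfolding simple_graph_def by force
    then have False if "d \<in> edges G" "Inl ` d = Inr ` d'" for d and d' :: "'b set"
      using that by (cases "d = {}") auto
    then show ?thesis by blast
  qed
  moreover have "inj_on ((`) (Inl :: 'a \<Rightarrow> 'a + 'b)) (edges G)"
    "inj_on ((`) (Inr :: 'b \<Rightarrow> 'a + 'b)) (edges H)"
    by (auto intro!: inj_onI simp: inj_image_eq_iff)
  ultimately show ?thesis
    using assms[THEN simple_graph_finite_edges]
    unfolding disjoint_union_def by (simp add: card_Un_disjoint card_image)
qed

lemma card_edges_copies:
  assumes "simple_graph G"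
  shows "card (edges (copies t G)) = t * card (edges G)"
proof -
  have "edges (copies t G) = (\<lambda>(i, e). Pair i ` e) ` ({..<t} \<times> edges G)"
    unfolding copies_def by auto
  moreover have "inj_on (\<lambda>(i, e). Pair i ` e) ({..<t} \<times> edges G)"
  proof (rule inj_onI, clarsimp)
    fix i e j d
    assume *: "e \<in> edges G" "d \<in> edges G" "Pair i ` e = Pair j ` d"
    have "e \<noteq> {}" using * assms unfolding simple_graph_def by force
    then have "i = j" using * by blast
    then show "i = j \<and> e = d" using * by (auto simp: inj_image_eq_iff inj_def)
  qed
  ultimately show ?thesis by (simp add: card_image card_cartesian_product)
qed

lemma star_centers_disjoint_union:
  assumes "star_centers G Z" "star_centers H Y"
  shows "star_centers (disjoint_union G H) (Inl ` Z \<union> Inr ` Y)" (is "star_centers ?U ?X")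
  unfolding star_centers_def
proof (intro conjI ballI)
  show "?X \<subseteq> verts ?U"
    using assms unfolding star_centers_def disjoint_union_def by auto
next
  fix z assume "z \<in> ?X"
  then consider y where "y \<in> Z" "z = Inl y" | y where "y \<in> Y" "z = Inr y" by auto
  then show "\<exists>e\<in>edges ?U. z \<in> e"
  proof cases
    case 1
    then obtain e where "e \<in> edges G" "y \<in> e" using assms(1) unfolding star_centers_def by meson
    then show ?thesis using 1 unfolding disjoint_union_def by auto
  next
    case 2
    then obtain e where "e \<in> edges H" "y \<in> e" using assms(2) unfolding star_centers_def by meson
    then show ?thesis using 2 unfolding disjoint_union_def by auto
  qed
next
  fix e assume "e \<in> edges ?U"
  then consider d where "d \<in> edges G" "e = Inl ` d" | d where "d \<in> edges H" "e = Inr ` d"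
    unfolding disjoint_union_def by auto
  then show "\<exists>z\<in>?X. \<exists>x\<in>verts ?U - ?X.
      e = {z, x} \<and> (\<forall>e'\<in>edges ?U. x \<in> e' \<longrightarrow> e' = e)"
  proof cases
    case 1
    then obtain z x where zx: "z \<in> Z" "x \<in> verts G - Z" "d = {z, x}"
      "\<forall>e'\<in>edges G. x \<in> e' \<longrightarrow> e' = d" using assms(1) unfolding star_centers_def by meson
    have "e' = e" if e': "e' \<in> edges ?U" "Inl x \<in> e'" for e'
    proof -
      obtain d' where d': "d' \<in> edges G" "e' = Inl ` d'"
        using e' unfolding disjoint_union_def by auto
      then have "d' = d" using e'(2) zx(4) by blast
      then show ?thesis using d'(2) 1(2) by simp
    qed
    then have "e = {Inl z, Inl x} \<and> (\<forall>e'\<in>edges ?U. Inl x \<in> e' \<longrightarrow> e' = e)"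
      using 1(2) zx(3) by auto
    moreover have "Inl z \<in> ?X" using zx(1) by simp
    moreover have "Inl x \<in> verts ?U - ?X" using zx(2) by (auto simp: disjoint_union_def)
    ultimately show ?thesis by (intro bexI)
  next
    case 2
    then obtain z x where zx: "z \<in> Y" "x \<in> verts H - Y" "d = {z, x}"
      "\<forall>e'\<in>edges H. x \<in> e' \<longrightarrow> e' = d" using assms(2) unfolding star_centers_def by meson
    have "e' = e" if e': "e' \<in> edges ?U" "Inr x \<in> e'" for e'
    proof -
      obtain d' where d': "d' \<in> edges H" "e' = Inr ` d'"
        using e' unfolding disjoint_union_def by auto
      then have "d' = d" using e'(2) zx(4) by blast
      then show ?thesis using d'(2) 2(2) by simp
    qed
    then have "e = {Inr z, Inr x} \<and> (\<forall>e'\<in>edges ?U. Inr x \<in> e' \<longrightarrow> e' = e)"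
      using 2(2) zx(3) by auto
    moreover have "Inr z \<in> ?X" using zx(1) by simp
    moreover have "Inr x \<in> verts ?U - ?X" using zx(2) by (auto simp: disjoint_union_def)
    ultimately show ?thesis by (intro bexI)
  qed
qed

lemma star_centers_copies:
  assumes "star_centers G Z"
  shows "star_centers (copies t G) ({..<t} \<times> Z)"
  unfolding star_centers_def
proof (intro conjI ballI)
  show "{..<t} \<times> Z \<subseteq> verts (copies t G)"
    using assms unfolding star_centers_def copies_def by auto
next
  fix z assume "z \<in> {..<t} \<times> Z"
  then obtain i y e where "i < t" "z = (i, y)" "e \<in> edges G" "y \<in> e"
    using assms unfolding star_centers_def by blast
  then show "\<exists>e\<in>edges (copies t G). z \<in> e" unfolding copies_def by auto
next
  fix e assume "e \<in> edges (copies t G)"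
  then obtain i d where id: "i < t" "d \<in> edges G" "e = Pair i ` d"
    unfolding copies_def by auto
  then obtain z x where zx: "z \<in> Z" "x \<in> verts G - Z" "d = {z, x}"
      "\<forall>e'\<in>edges G. x \<in> e' \<longrightarrow> e' = d" using assms unfolding star_centers_def by meson
  have leaf: "e' = e" if "e' \<in> edges (copies t G)" "(i, x) \<in> e'" for e'
  proof -
    obtain j d' where d': "d' \<in> edges G" "e' = Pair j ` d'"
      using \<open>e' \<in> edges (copies t G)\<close> unfolding copies_def by auto
    with \<open>(i, x) \<in> e'\<close> have "j = i" "x \<in> d'" by auto
    then have "d' = d" using d'(1) zx(4) by blast
    then show ?thesis using d'(2) id(3) \<open>j = i\<close> by simp
  qed
  have "e = {(i, z), (i, x)} \<and> (\<forall>e'\<in>edges (copies t G). (i, x) \<in> e' \<longrightarrow> e' = e)"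
    using id(3) zx(3) leaf by blast
  moreover have "(i, z) \<in> {..<t} \<times> Z"
    "(i, x) \<in> verts (copies t G) - {..<t} \<times> Z"
    using id zx(1-3) by (auto simp: copies_def)
  ultimately show "\<exists>z\<in>{..<t} \<times> Z. \<exists>x\<in>verts (copies t G) - {..<t} \<times> Z.
      e = {z, x} \<and> (\<forall>e'\<in>edges (copies t G). x \<in> e' \<longrightarrow> e' = e)"
    by (intro bexI)
qed

lemma edges_path_graph_3: "edges (path_graph 3) = {{0, 1}, {1, 2}}"
proof -
  have "Suc i < 3 \<longleftrightarrow> i = 0 \<or> i = 1" for i by auto
  then show ?thesis unfolding path_graph_def by (auto simp: numeral_2_eq_2)
qed

lemma card_edges_path_graph_3: "card (edges (path_graph 3)) = 2"
  unfolding edges_path_graph_3 by (auto simp: doubleton_eq_iff card_insert_if)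

lemma simple_graph_path_graph_3: "simple_graph (path_graph 3)"
  unfolding simple_graph_def edges_path_graph_3 by (auto simp: path_graph_def)

lemma star_centers_path_graph_3: "star_centers (path_graph 3) {1}"
  unfolding star_centers_def edges_path_graph_3
  by (auto simp: path_graph_def insert_commute)

section \<open>The components of a star forest\<close>

lemma equiv_connectivity: "equiv (verts G) (connectivity G)"
proof (rule equivI)
  have "sym ((adjacency G)\<^sup>*)"
    by (rule sym_rtrancl) (auto simp: sym_def adjacency_def insert_commute)
  then show "sym (connectivity G)" unfolding connectivity_def sym_def by blast
qed (auto simp: connectivity_def refl_on_def trans_def)

lemma edge_in_connectivity_class:
  assumes "simple_graph G" "e \<in> edges G" "x \<in> e" "x \<in> W" "W \<in> verts G // connectivity G"
  shows "e \<subseteq> W"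
proof
  fix y assume "y \<in> e"
  have e: "e \<subseteq> verts G" "card e = 2" using assms unfolding simple_graph_def by auto
  have "(x, y) \<in> (adjacency G)\<^sup>*"
  proof (cases "x = y")
    case False
    with e assms(3) \<open>y \<in> e\<close> have "e = {x, y}" by (auto simp: card_2_iff)
    then show ?thesis using assms(2) by (auto simp: adjacency_def)
  qed simp
  then have "(x, y) \<in> connectivity G"
    using e assms(3) \<open>y \<in> e\<close> by (auto simp: connectivity_def)
  then show "y \<in> W"
    using in_quotient_imp_closed[OF equiv_connectivity assms(5,4)] by blast
qed

lemma components_eqI:
  assumes "C \<in> components G" "D \<in> components G" "x \<in> verts C" "x \<in> verts D"
  shows "C = D"
proof -
  obtain W V where "W \<in> verts G // connectivity G" "V \<in> verts G // connectivity G"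
    "C = induced_subgraph G W" "D = induced_subgraph G V"
    using assms unfolding components_def by auto
  then show ?thesis
    using quotient_disj[OF equiv_connectivity, of W G V] assms(3,4)
    by (auto simp: induced_subgraph_def)
qed

lemma verts_component_subset:
  assumes "C \<in> components G" shows "verts C \<subseteq> verts G"
  using assms in_quotient_imp_subset[OF equiv_connectivity]
  unfolding components_def induced_subgraph_def by fastforce

lemma incident_edge_in_component:
  assumes "simple_graph G" "C \<in> components G" "e \<in> edges G" "x \<in> e" "x \<in> verts C"
  shows "e \<in> edges C"
  using assms edge_in_connectivity_class[OF assms(1,3,4)]
  unfolding components_def induced_subgraph_def by auto

lemma edges_eq_Union_components:
  assumes "simple_graph G" shows "edges G = (\<Union>C\<in>components G. edges C)"
proof
  show "(\<Union>C\<in>components G. edges C) \<subseteq> edges G"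
    unfolding components_def induced_subgraph_def by auto
  show "edges G \<subseteq> (\<Union>C\<in>components G. edges C)"
  proof
    fix e assume e: "e \<in> edges G"
    then obtain x where x: "x \<in> e" "x \<in> verts G"
      using assms unfolding simple_graph_def by (fastforce simp: card_2_iff)
    define C where "C = induced_subgraph G (connectivity G `` {x})"
    have "C \<in> components G" unfolding C_def components_def using x by (auto intro: quotientI)
    moreover have "x \<in> verts C"
      using equiv_class_self[OF equiv_connectivity x(2)]
      unfolding C_def induced_subgraph_def by simp
    ultimately show "e \<in> (\<Union>C\<in>components G. edges C)"
      using incident_edge_in_component[OF assms _ e x(1)] by auto
  qed
qed

lemma finite_components:
  assumes "simple_graph G" shows "finite (components G)"
proof -
  have "verts G // connectivity G \<subseteq> Pow (verts G)"
    using in_quotient_imp_subset[OF equiv_connectivity] by blast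
  then have "finite (verts G // connectivity G)"
    using assms unfolding simple_graph_def by (meson finite_Pow_iff finite_subset)
  then show ?thesis unfolding components_def by simp
qed

lemma card_edges_eq_sum_components:
  assumes "simple_graph G"
  shows "card (edges G) = (\<Sum>C\<in>components G. card (edges C))"
  unfolding edges_eq_Union_components[OF assms]
proof (rule card_UN_disjoint)
  show "finite (components G)" by (rule finite_components[OF assms])
  show "\<forall>C\<in>components G. finite (edges C)"
    using simple_graph_finite_edges[OF assms] edges_eq_Union_components[OF assms]
    by (auto intro: finite_subset)
  show "\<forall>C\<in>components G. \<forall>D\<in>components G. C \<noteq> D \<longrightarrow> edges C \<inter> edges D = {}"
  proof (intro ballI impI, rule ccontr)
    fix C D assume CD: "C \<in> components G" "D \<in> components G" "C \<noteq> D" "edges C \<inter> edges D \<noteq> {}"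
    then obtain e where e: "e \<in> edges C" "e \<in> edges D" by blast
    then have "e \<in> edges G" "e \<subseteq> verts C" "e \<subseteq> verts D"
      using CD unfolding components_def induced_subgraph_def by auto
    moreover from this obtain x where "x \<in> e"
      using assms unfolding simple_graph_def by (fastforce simp: card_2_iff)
    ultimately show False using components_eqI[OF CD(1,2)] CD(3) by blast
  qed
qed

text \<open>
  One center per component works because distinct components share no vertex and every edge at a
  vertex of a component stays in it. A component without edges is an isolated vertex; its vertex
  sum \<open>0\<close> would not exceed the leaf sums, so it cannot count as a center.
\<close>

lemma star_forest_obtains_centers:
  assumes "star_forest G" "\<And>C. C \<in> components G \<Longrightarrow> edges C \<noteq> {}"
  obtains Z where "star_centers G Z" "card Z = card (components G)"
proof -
  have G: "simple_graph G" using assms(1) unfolding star_forest_def by simp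
  have "\<forall>C\<in>components G. \<exists>v L. v \<notin> L \<and> C = SGraph (insert v L) ((\<lambda>x. {v, x}) ` L)"
    using assms(1) unfolding star_forest_def n_star_def by blast
  then obtain c L where cL: "\<And>C. C \<in> components G \<Longrightarrow> c C \<notin> L C"
    "\<And>C. C \<in> components G \<Longrightarrow> C = SGraph (insert (c C) (L C)) ((\<lambda>x. {c C, x}) ` L C)"
    by metis
  have V: "verts C = insert (c C) (L C)" and E: "edges C = (\<lambda>x. {c C, x}) ` L C"
    if "C \<in> components G" for C
    using cL(2)[OF that] by (metis sgraph.sel)+
  have "inj_on c (components G)"
  proof (rule inj_onI)
    fix C D assume "C \<in> components G" "D \<in> components G" "c C = c D"
    then show "C = D" using V[of C] V[of D] components_eqI[of C G D "c C"] by auto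
  qed
  then have "card (c ` components G) = card (components G)" by (rule card_image)
  moreover have "star_centers G (c ` components G)"
    unfolding star_centers_def
  proof (intro conjI ballI)
    show "c ` components G \<subseteq> verts G" using verts_component_subset V by fastforce
  next
    fix z assume "z \<in> c ` components G"
    then obtain C where C: "C \<in> components G" "z = c C" by blast
    then obtain x where "x \<in> L C" using assms(2)[OF C(1)] E[OF C(1)] by auto
    then have "{z, x} \<in> edges G" using C E[OF C(1)] edges_eq_Union_components[OF G] by auto
    then show "\<exists>e\<in>edges G. z \<in> e" by auto
  next
    fix e assume "e \<in> edges G"
    then obtain C where C: "C \<in> components G" "e \<in> edges C"
      using edges_eq_Union_components[OF G] by blast
    then obtain x where x: "x \<in> L C" "e = {c C, x}" using E[OF C(1)] by auto
    have "x \<notin> c ` components G"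
    proof
      assume "x \<in> c ` components G"
      then obtain D where D: "D \<in> components G" "x = c D" by blast
      then have "C = D" using components_eqI[OF C(1) D(1), of x] V[OF C(1)] V[OF D(1)] x by simp
      then show False using cL(1)[OF C(1)] D x by simp
    qed
    moreover have "x \<in> verts G" using verts_component_subset[OF C(1)] V[OF C(1)] x by auto
    moreover have "e' = e" if e': "e' \<in> edges G" "x \<in> e'" for e'
    proof -
      have "e' \<in> edges C"
        using incident_edge_in_component[OF G C(1) e'] V[OF C(1)] x by simp
      then obtain y where "e' = {c C, y}" using E[OF C(1)] by auto
      then show ?thesis using x e'(2) cL(1)[OF C(1)] by auto
    qed
    ultimately show "\<exists>z\<in>c ` components G. \<exists>x\<in>verts G - c ` components G.
        e = {z, x} \<and> (\<forall>e'\<in>edges G. x \<in> e' \<longrightarrow> e' = e)"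
      using C x by blast
  qed
  ultimately show ?thesis using that by blast
qed

section \<open>Counting center sums\<close>

lemma sum_ge_of_all_greater:
  fixes S :: "nat set"
  assumes "finite S" "\<And>s. s \<in> S \<Longrightarrow> N < s"
  shows "2 * card S * N + card S * (card S + 1) \<le> 2 * \<Sum>S"
  using assms
proof (induction rule: finite_linorder_max_induct)
  case (insert b A)
  have "insert b A \<subseteq> {N<..b}" using insert by (auto simp: less_imp_le)
  then have "card (insert b A) \<le> b - N"
    by (metis card_greaterThanAtMost card_mono finite_greaterThanAtMost)
  then have "N + card A + 1 \<le> b" using insert by (auto simp: card_insert_if)
  then show ?case using insert by (auto simp: algebra_simps)
qed simp

text \<open>
  Every label is already the sum at a leaf, so the sum at a center, which is positive and differs
  from all leaf sums, is not a label.
\<close>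

lemma antimagic_center_sum_greater:
  assumes "simple_graph G" "star_centers G Z" "antimagic_labeling G f" "z \<in> Z"
  shows "card (edges G) < vertex_sum G f z"
proof (rule ccontr)
  assume small: "\<not> card (edges G) < vertex_sum G f z"
  have fin: "finite (edges G)" by (rule simple_graph_finite_edges[OF assms(1)])
  have bij: "f ` edges G = {1..card (edges G)}"
    using assms(3) unfolding antimagic_labeling_def bij_betw_def by simp
  obtain d where d: "d \<in> edges G" "z \<in> d" using assms(2,4) unfolding star_centers_def by blast
  have "0 < f d" using bij d(1) by (metis imageI atLeastAtMost_iff zero_less_one order_less_le_trans)
  also have "f d \<le> vertex_sum G f z"
    unfolding vertex_sum_def by (rule member_le_sum) (use d fin in auto)
  finally have "vertex_sum G f z \<in> f ` edges G" using bij small by auto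
  then obtain e where e: "e \<in> edges G" "vertex_sum G f z = f e" by blast
  \<comment> \<open>The leaf of the edge whose label is the sum at \<open>z\<close> competes with \<open>z\<close>.\<close>
  obtain x where x: "x \<in> verts G - Z" "x \<in> e" "\<forall>e'\<in>edges G. x \<in> e' \<longrightarrow> e' = e"
    using assms(2) e(1) unfolding star_centers_def by (metis insertCI)
  have "{e' \<in> edges G. x \<in> e'} = {e}" using x(2,3) e(1) by blast
  then have "vertex_sum G f x = f e" unfolding vertex_sum_def by simp
  moreover have "z \<in> verts G" "z \<noteq> x" using assms(2,4) x unfolding star_centers_def by auto
  ultimately show False
    using assms(3) e(2) x(1) unfolding antimagic_labeling_def by (metis DiffD1)
qed

text \<open>
  Each edge has just one end among the centers, so the sums at \<open>Y\<close> add up to the labels of the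
  edges meeting \<open>Y\<close>; those labels and the \<open>r\<close> remaining ones together give \<open>1 + \<dots> + N\<close>.
\<close>

lemma antimagic_centers_inequality:
  fixes G :: "'a sgraph"
  defines "N \<equiv> card (edges G)"
  assumes G: "simple_graph G" and Z: "star_centers G Z" and f: "antimagic_labeling G f"
    and Y: "Y \<subseteq> Z" and r: "r = card {e \<in> edges G. e \<inter> Y = {}}"
  shows "2 * card Y * N + card Y * (card Y + 1) + r * (r + 1) \<le> N * (N + 1)"
proof -
  define A B where "A = {e \<in> edges G. e \<inter> Y = {}}" and "B = {e \<in> edges G. e \<inter> Y \<noteq> {}}"
  have fin: "finite (edges G)" by (rule simple_graph_finite_edges[OF G])
  have AB: "edges G = A \<union> B" "A \<inter> B = {}" unfolding A_def B_def by auto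
  have finAB: "finite A" "finite B" using fin unfolding A_def B_def by auto
  have inj: "inj_on f (edges G)" and im: "f ` edges G = {1..N}"
    using f unfolding antimagic_labeling_def bij_betw_def N_def by auto
  have YV: "Y \<subseteq> verts G" using Y Z unfolding star_centers_def by blast
  have finY: "finite Y" using YV G unfolding simple_graph_def by (auto intro: finite_subset)

  have "sum f (edges G) = \<Sum>{1..N}" using sum.reindex[OF inj, of id] im by simp
  then have total: "2 * sum f (edges G) = N * (N + 1)"
    using gauss_sum_from_Suc_0[of N, where 'a = nat] by (simp del: mult_Suc_right)

  have "inj_on f A" using inj AB by (auto intro: inj_on_subset)
  then have "sum f A = \<Sum>(f ` A)" "card (f ` A) = r"
    using sum.reindex[of f A id] r by (auto simp: card_image A_def)
  moreover have "0 < s" if "s \<in> f ` A" for s using that im AB(1) by fastforce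
  ultimately have avoid: "r * (r + 1) \<le> 2 * sum f A"
    using sum_ge_of_all_greater[of "f ` A" 0] finAB by simp

  have one_center: "y = y'" if "e \<in> edges G" "y \<in> e" "y' \<in> e" "y \<in> Y" "y' \<in> Y" for e y y'
  proof -
    obtain z x where "e = {z, x}" "x \<in> verts G - Z"
      using Z \<open>e \<in> edges G\<close> unfolding star_centers_def by meson
    then show ?thesis using that(2-5) Y by auto
  qed
  have "B = (\<Union>y\<in>Y. {e \<in> edges G. y \<in> e})" unfolding B_def by auto
  then have "sum f B = (\<Sum>y\<in>Y. vertex_sum G f y)"
    unfolding vertex_sum_def using finY fin one_center
    by (simp, subst sum.UNION_disjoint) auto
  moreover have inj_sum: "inj_on (vertex_sum G f) Y"
    using f YV unfolding antimagic_labeling_def inj_on_def by blast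
  ultimately have "sum f B = \<Sum>(vertex_sum G f ` Y)" by (simp add: sum.reindex)
  then have "2 * card Y * N + card Y * (card Y + 1) \<le> 2 * sum f B"
    using sum_ge_of_all_greater[of "vertex_sum G f ` Y" N] finY Y
      antimagic_center_sum_greater[OF G Z f] card_image[OF inj_sum]
    by (auto simp: N_def)
  moreover have "sum f (edges G) = sum f A + sum f B"
    using sum.union_disjoint[OF finAB AB(2), of f] AB(1) by simp
  ultimately show ?thesis using avoid total by linarith
qed

section \<open>The bounds\<close>

lemma antimagic_union_paths_inequalities:
  fixes G :: "'a sgraph"
  defines "m \<equiv> card (edges G)"
  assumes G: "simple_graph G" and Z: "star_centers G Z" and q: "card Z = q"
    and anti: "antimagic (disjoint_union G (copies t (path_graph 3)))"
  shows "t \<le> 2 * m + 1"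
    and "2 * (q + t) * (m + 2 * t) + (q + t) * (q + t + 1) \<le> (m + 2 * t) * (m + 2 * t + 1)"
proof -
  define P where "P = copies t (path_graph 3)"
  define H where "H = disjoint_union G P"
  define Y where "Y = {..<t} \<times> {1::nat}"
  define X :: "('a + nat \<times> nat) set" where "X = Inl ` Z \<union> Inr ` Y"
  have P: "simple_graph P" "star_centers P Y" "card (edges P) = 2 * t"
    unfolding P_def Y_def
    by (simp_all add: simple_graph_copies simple_graph_path_graph_3 star_centers_copies
        star_centers_path_graph_3[simplified] card_edges_copies card_edges_path_graph_3)
  have H: "simple_graph H" "star_centers H X" "card (edges H) = m + 2 * t"
    unfolding H_def X_def m_def using G Z P
    by (simp_all add: simple_graph_disjoint_union star_centers_disjoint_union
        card_edges_disjoint_union)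
  obtain f where f: "antimagic_labeling H f"
    using anti unfolding antimagic_def H_def P_def by blast

  \<comment> \<open>For the quadratic inequality the chosen centers are all of \<open>X\<close>, and no edge avoids them.\<close>
  have "finite Z" using Z G unfolding star_centers_def simple_graph_def by (auto intro: finite_subset)
  then have "card X = q + t"
    unfolding X_def Y_def by (subst card_Un_disjoint) (auto simp: card_image q card_cartesian_product)
  moreover have "{e \<in> edges H. e \<inter> X = {}} = {}"
    using star_centers_meet_edge[OF H(2)] by auto
  ultimately show
    "2 * (q + t) * (m + 2 * t) + (q + t) * (q + t + 1) \<le> (m + 2 * t) * (m + 2 * t + 1)"
    using antimagic_centers_inequality[OF H(1,2) f subset_refl refl] H(3) by simp

  \<comment> \<open>For the linear bound only the path centers are chosen, and the edges of \<open>G\<close> avoid them.\<close>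
  have "{e \<in> edges H. e \<inter> Inr ` Y = {}} = (`) Inl ` edges G"
  proof -
    have "Inr ` d \<inter> Inr ` Y \<noteq> ({} :: ('a + nat \<times> nat) set)" if "d \<in> edges P" for d
      using star_centers_meet_edge[OF P(2) that] by auto
    moreover have "Inl ` d \<inter> Inr ` Y = ({} :: ('a + nat \<times> nat) set)" for d by auto
    ultimately show ?thesis unfolding H_def disjoint_union_def by auto
  qed
  moreover have "card ((`) Inl ` edges G :: ('a + nat \<times> nat) set set) = m"
    unfolding m_def by (rule card_image) (auto intro!: inj_onI simp: inj_image_eq_iff)
  moreover have "card (Inr ` Y :: ('a + nat \<times> nat) set) = t"
    unfolding Y_def by (simp add: card_image card_cartesian_product)
  moreover have "Inr ` Y \<subseteq> X" unfolding X_def by simp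
  ultimately have "2 * t * (m + 2 * t) + t * (t + 1) + m * (m + 1) \<le> (m + 2 * t) * (m + 2 * t + 1)"
    using antimagic_centers_inequality[OF H(1,2) f _ refl, of "Inr ` Y"] H(3) by simp
  then have "t * t \<le> t * (2 * m + 1)" by (simp add: algebra_simps)
  then show "t \<le> 2 * m + 1" by (metis nat_mult_le_cancel1 neq0_conv zero_le)
qed

lemma quadratic_bound:
  fixes m q t :: real
  assumes "2 * (q + t) * (m + 2 * t) + (q + t) * (q + t + 1) \<le> (m + 2 * t) * (m + 2 * t + 1)"
    and "2 * q \<le> m + 1 / 2"
  shows "t \<le> - q * (3 + 2 * sqrt 2) + (1 + sqrt 2) * (m + 1 / 2)"
proof -
  define a where "a = m + 1 / 2"
  \<comment> \<open>The hypothesis is quadratic in \<open>t\<close>; completing the square gives this, even with \<open>- 1/4\<close> on the right.\<close>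
  have "(t - (a - 3 * q))\<^sup>2 \<le> 2 * (a - 2 * q)\<^sup>2"
    using assms(1) unfolding a_def by (simp add: algebra_simps power2_eq_square)
  also have "\<dots> = (sqrt 2 * (a - 2 * q))\<^sup>2" by (simp add: power_mult_distrib)
  finally have "t - (a - 3 * q) \<le> sqrt 2 * (a - 2 * q)"
    by (rule power2_le_imp_le) (use assms(2) in \<open>simp add: a_def\<close>)
  then show ?thesis unfolding a_def[symmetric] by (simp add: algebra_simps)
qed

theorem corollary4:
  fixes G :: "'a sgraph" and m q :: nat
  assumes "star_forest G"
    and "m = card (edges G)"
    and "q = card (components G)"
    and "\<And>C. C \<in> components G \<Longrightarrow> card (edges C) \<ge> 3"
  shows "tau G \<le> ereal (min (- real q * (3 + 2 * sqrt 2) + (1 + sqrt 2) * (real m + 1 / 2))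
                            (2 * real m + 1))"
proof (cases "antimagic G")
  case True
  have G: "simple_graph G" using assms(1) unfolding star_forest_def by simp
  have "edges C \<noteq> {}" if "C \<in> components G" for C using assms(4)[OF that] by auto
  then obtain Z where Z: "star_centers G Z" "card Z = q"
    using star_forest_obtains_centers[OF assms(1)] assms(3) by metis
  have "3 * q \<le> m"
    unfolding assms(2) card_edges_eq_sum_components[OF G]
    using sum_bounded_below[of "components G" 3 "\<lambda>C. card (edges C)"] assms(3,4) by simp
  have "real t \<le> min (- real q * (3 + 2 * sqrt 2) + (1 + sqrt 2) * (real m + 1 / 2))
                     (2 * real m + 1)"
    if "tau_admissible G t" for t
  proof -
    have anti: "antimagic (disjoint_union G (copies t (path_graph 3)))"
      using that unfolding tau_admissible_def by simp
    note ineqs = antimagic_union_paths_inequalities[OF G Z anti, folded assms(2)]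
    have "real (2 * (q + t) * (m + 2 * t) + (q + t) * (q + t + 1))
        \<le> real ((m + 2 * t) * (m + 2 * t + 1))"
      using ineqs(2) by (rule of_nat_mono)
    then have "real t \<le> - real q * (3 + 2 * sqrt 2) + (1 + sqrt 2) * (real m + 1 / 2)"
      using \<open>3 * q \<le> m\<close> by (intro quadratic_bound) (simp_all add: algebra_simps)
    moreover have "real t \<le> 2 * real m + 1" using ineqs(1) by linarith
    ultimately show ?thesis by simp
  qed
  then show ?thesis using True unfolding tau_def by (auto intro!: SUP_least)
qed (simp add: tau_def)

end
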